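(* Let $f:\mathbb{R}^d\to\mathbb{R}$ be continuously differentiable, convex, and $L$-smooth for some $L>0$, and suppose $f$ attains its minimum $f^*=f(x^* )$ at a point $x^*\in\mathbb{R}^d$. Let $(\alpha_k)_{k\ge1}$ be positive step sizes with $\lim_{k\to\infty}\alpha_k=0$ and $\sum_{k=1}^\infty\alpha_k=\infty$. Let $x_0$ be an $\mathbb{R}^d$-valued random variable with $\mathbb{E}|f(x_0)|<\infty$, and let $(x_k)$ be generated by vanilla SGD, $x_k=x_{k-1}-\alpha_k\nabla f(x_{k-1})+\alpha_k\xi_k$ for $k\ge1$, where the $\mathbb{R}^d$-valued noise satisfies, for constants $M,V\ge0$ and all $k\ge1$, $$\mathbb{E}[\xi_k\mid\mathcal{F}_{k-1}]=0,\qquad \mathbb{E}[\|\xi_k\|^2\mid\mathcal{F}_{k-1}]\le M+V\|\nabla f(x_{k-1})\|^2 .$$ Define the time average $$\bar x_n=\frac{\sum_{k=1}^n\alpha_kx_{k-1}}{\sum_{k=1}^n\alpha_k},\qquad n\ge1 .$$ Then $$\lim_{n\to\infty}\mathbb{E} f(\bar x_n)=f(x^* )=f^* .$$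
   Context: $\mathcal{F}_k=\sigma(x_0,\xi_1,\dots,\xi_k)$ is the filtration generated by the initial value and the noise. $f$ is $L$-smooth if $\|\nabla f(x)-\nabla f(y)\|\le L\|x-y\|$ for all $x,y\in\mathbb{R}^d$. *)

theory Defs
  imports "HOL-Probability.Probability"
begin

definition grad :: "('a::real_inner \<Rightarrow> real) \<Rightarrow> 'a \<Rightarrow> 'a" where
  "grad f x = (THE D. GDERIV f x :> D)"

definition continuously_differentiable :: "('a::real_inner \<Rightarrow> real) \<Rightarrow> bool" where
  "continuously_differentiable f \<longleftrightarrow>
     (\<forall>x. f differentiable (at x)) \<and> continuous_on UNIV (grad f)"

definition L_smooth :: "real \<Rightarrow> ('a::real_inner \<Rightarrow> real) \<Rightarrow> bool" where
  "L_smooth L f \<longleftrightarrow> (\<forall>x y. norm (grad f x - grad f y) \<le> L * norm (x - y))"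

text \<open>The \<open>\<sigma>\<close>-algebra generated by the initial value and the first \<open>k\<close> noise vectors,
  as a measure space over \<open>space P\<close> of which only the measurable sets are relevant.
  The value \<open>\<xi> 0\<close> is not used.\<close>
definition sgd_filtration ::
  "'w measure \<Rightarrow> ('w \<Rightarrow> 'a::topological_space) \<Rightarrow> (nat \<Rightarrow> 'w \<Rightarrow> 'a) \<Rightarrow> nat \<Rightarrow> 'w measure" where
  "sgd_filtration P x0 \<xi> k = sigma (space P)
     ({x0 -` A \<inter> space P | A. A \<in> sets borel} \<union>
      (\<Union>i\<in>{1..k}. {\<xi> i -` A \<inter> space P | A. A \<in> sets borel}))"

text \<open>The library provides conditional expectations of real and of extended nonnegative
  functions only; for random vectors the conditional expectation is taken componentwise.\<close>
definition vec_cond_exp ::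
  "'w measure \<Rightarrow> 'w measure \<Rightarrow> ('w \<Rightarrow> real ^ 'd) \<Rightarrow> 'w \<Rightarrow> real ^ 'd" where
  "vec_cond_exp P F X \<omega> = (\<chi> i. real_cond_exp P F (\<lambda>\<omega>'. X \<omega>' $ i) \<omega>)"

definition time_average ::
  "(nat \<Rightarrow> real) \<Rightarrow> (nat \<Rightarrow> 'w \<Rightarrow> 'a::real_vector) \<Rightarrow> nat \<Rightarrow> 'w \<Rightarrow> 'a" where
  "time_average \<alpha> x n \<omega> = (\<Sum>k=1..n. \<alpha> k *\<^sub>R x (k - 1) \<omega>) /\<^sub>R (\<Sum>k=1..n. \<alpha> k)"

end

theory Submission
  imports Defs
begin

text \<open>
  Measured from a fixed point, the iterates need not have finite second moment, since \<open>x 0\<close> need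
  not be square integrable. The Lyapunov function is therefore \<open>D k = \<^bold>E \<parallel>x k - Z\<parallel>\<^sup>2\<close> for the random
  reference point \<open>Z\<close> that equals \<open>xstar\<close> where \<open>\<parallel>x 0\<parallel> \<le> R\<close> and \<open>x 0\<close> elsewhere: it is
  measurable at time \<open>0\<close>, \<open>x 0 - Z\<close> is bounded, and \<open>\<^bold>E f(Z)\<close> tends to \<open>f xstar\<close> as \<open>R\<close> grows, by
  dominated convergence. The gradient inequality against \<open>Z\<close> and \<open>\<parallel>\<nabla>f\<parallel>\<^sup>2 \<le> 4 L (f - f xstar)\<close> give, for small step
  sizes, \<open>\<alpha> k (\<^bold>E f(x (k - 1)) - f xstar) \<le> D (k - 1) - D k + 2 \<alpha> k (\<^bold>E f(Z) - f xstar) + M (\<alpha> k)\<^sup>2\<close>.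
  Summation, division by \<open>\<Sum>\<alpha>\<close> and Jensen's inequality conclude.
\<close>

section \<open>Gradient inequalities for smooth convex functions\<close>

text \<open>\<open>grad\<close> is a definite description, so existence and uniqueness are both
  owed. The derivative is linear, hence the inner product with the vector of its values on
  \<open>Basis\<close>, and uniqueness of derivatives leaves no other candidate.\<close>

lemma GDERIV_grad:
  fixes f :: "'a::euclidean_space \<Rightarrow> real"
  assumes "f differentiable (at x)"
  shows "GDERIV f x :> grad f x"
proof -
  obtain f' where f': "(f has_derivative f') (at x)"
    using assms by (auto simp: differentiable_def)
  then interpret bounded_linear f' by (rule has_derivative_bounded_linear)
  have "f' h = inner h (\<Sum>b\<in>Basis. f' b *\<^sub>R b)" for h
  proof -
    have "f' h = f' (\<Sum>b\<in>Basis. inner h b *\<^sub>R b)"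
      by (simp only: euclidean_representation)
    also have "\<dots> = (\<Sum>b\<in>Basis. inner h b * f' b)"
      by (simp add: sum scaleR)
    also have "\<dots> = inner h (\<Sum>b\<in>Basis. f' b *\<^sub>R b)"
      by (simp add: inner_sum_right mult.commute)
    finally show ?thesis .
  qed
  then have "GDERIV f x :> (\<Sum>b\<in>Basis. f' b *\<^sub>R b)"
    using f' unfolding gderiv_def by (metis (no_types, lifting) ext)
  then show ?thesis
    unfolding grad_def
  proof (rule theI)
    fix D assume D: "GDERIV f x :> D"
    have "(\<lambda>h. inner h D) = f'"
      using has_derivative_unique[OF D[unfolded gderiv_def] f'] .
    then have "inner h D = inner h (\<Sum>b\<in>Basis. f' b *\<^sub>R b)" for h
      using \<open>\<And>h. f' h = _ h\<close> by (metis (no_types, lifting))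
    then show "D = (\<Sum>b\<in>Basis. f' b *\<^sub>R b)"
      using vector_eq_ldot by blast
  qed
qed

text \<open>Restriction to the line through \<open>x\<close> and \<open>y\<close> reduces this to
  one variable, where a convex function lies above its tangent at 0; the tangent is read off at
  1.\<close>

lemma convex_on_grad_inequality:
  fixes f :: "'a::euclidean_space \<Rightarrow> real"
  assumes convex: "convex_on UNIV f" and "f differentiable (at x)"
  shows "f x + inner (grad f x) (y - x) \<le> f y"
proof -
  define h where "h t = f (x + t *\<^sub>R (y - x))" for t :: real
  have "convex_on UNIV h"
  proof (rule convex_onI)
    fix t a b :: real assume t: "0 < t" "t < 1"
    have "x + ((1 - t) *\<^sub>R a + t *\<^sub>R b) *\<^sub>R (y - x) =
        (1 - t) *\<^sub>R (x + a *\<^sub>R (y - x)) + t *\<^sub>R (x + b *\<^sub>R (y - x))"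
      by (simp add: algebra_simps)
    then show "h ((1 - t) *\<^sub>R a + t *\<^sub>R b) \<le> (1 - t) * h a + t * h b"
      unfolding h_def using convex_onD[OF convex, of t] t by simp
  qed auto
  moreover have "(h has_real_derivative inner (grad f x) (y - x)) (at 0 within UNIV)"
  proof -
    have f: "(f has_derivative (\<lambda>v. inner v (grad f x))) (at (x + 0 *\<^sub>R (y - x)))"
      using GDERIV_grad[OF assms(2)] by (simp add: gderiv_def)
    have "((\<lambda>t::real. x + t *\<^sub>R (y - x)) has_derivative (\<lambda>t. t *\<^sub>R (y - x))) (at 0)"
      by (auto intro!: derivative_eq_intros)
    from has_derivative_compose[OF this f]
    have "(h has_derivative (\<lambda>t. inner (t *\<^sub>R (y - x)) (grad f x))) (at 0)"
      by (simp add: h_def[abs_def])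
    also have "(\<lambda>t. inner (t *\<^sub>R (y - x)) (grad f x)) = (*) (inner (grad f x) (y - x))"
      by (simp add: fun_eq_iff inner_commute)
    finally show ?thesis by (simp add: has_field_derivative_def)
  qed
  ultimately have "h 1 - h 0 \<ge> inner (grad f x) (y - x) * (1 - 0)"
    by (intro convex_on_imp_above_tangent[where A = UNIV]) auto
  then show ?thesis by (simp add: h_def)
qed

text \<open>Convexity gives a short route without integration along the segment: the gradient
  inequality is taken at \<open>y\<close> instead of \<open>x\<close>, and Cauchy-Schwarz with the
  Lipschitz bound pays for exchanging the gradients. The price is the coefficient \<open>L\<close>
  in place of the sharp \<open>L / 2\<close>.\<close>

lemma smooth_convex_upper_bound:
  fixes f :: "'a::euclidean_space \<Rightarrow> real"
  assumes "convex_on UNIV f" "\<And>x. f differentiable (at x)" "L_smooth L f"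
  shows "f y \<le> f x + inner (grad f x) (y - x) + L * (norm (y - x))\<^sup>2"
proof -
  have "f y + inner (grad f y) (x - y) \<le> f x"
    using assms by (intro convex_on_grad_inequality)
  then have "f y \<le> f x + inner (grad f x) (y - x) + inner (grad f y - grad f x) (y - x)"
    by (simp add: algebra_simps)
  also have "inner (grad f y - grad f x) (y - x) \<le> norm (grad f y - grad f x) * norm (y - x)"
    by (rule norm_cauchy_schwarz)
  also have "\<dots> \<le> L * (norm (y - x))\<^sup>2"
    using assms(3) by (auto simp: L_smooth_def power2_eq_square mult.assoc[symmetric] intro!: mult_right_mono)
  finally show ?thesis by simp
qed

text \<open>A gradient step of length \<open>1 / (2 * L)\<close> minimises the preceding quadratic
  bound along the negative gradient. It lowers \<open>f\<close> by at least
  \<open>(norm (grad f x))\<^sup>2 / (4 * L)\<close>, yet cannot go below \<open>m\<close>.\<close>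

lemma smooth_convex_grad_norm_bound:
  fixes f :: "'a::euclidean_space \<Rightarrow> real"
  assumes "convex_on UNIV f" "\<And>x. f differentiable (at x)" "L_smooth L f" "L > 0"
    and min: "\<And>y. m \<le> f y"
  shows "(norm (grad f x))\<^sup>2 \<le> 4 * L * (f x - m)"
proof -
  let ?g = "grad f x" and ?y = "x - (1 / (2 * L)) *\<^sub>R grad f x"
  have "m \<le> f ?y" by (rule min)
  also have "\<dots> \<le> f x + inner ?g (?y - x) + L * (norm (?y - x))\<^sup>2"
    using assms by (intro smooth_convex_upper_bound)
  also have "\<dots> = f x - (norm ?g)\<^sup>2 / (2 * L) + L * ((norm ?g)\<^sup>2 / (4 * L\<^sup>2))"
    by (simp add: power_divide power_mult_distrib power2_norm_eq_inner[of ?g, symmetric])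
  also have "\<dots> = f x - (norm ?g)\<^sup>2 / (4 * L)"
    using \<open>L > 0\<close> by (simp add: field_simps power2_eq_square)
  finally show ?thesis using \<open>L > 0\<close> by (simp add: field_simps)
qed

section \<open>Square-integrable random vectors\<close>

lemma norm_add_square_le:
  fixes a b :: "'a::real_inner"
  shows "(norm (a + b))\<^sup>2 \<le> 2 * (norm a)\<^sup>2 + 2 * (norm b)\<^sup>2"
  using zero_le_power2[of "norm (a - b)"]
  by (simp add: power2_norm_eq_inner inner_simps inner_commute)

lemma abs_inner_le_squares:
  fixes a b :: "'a::real_inner"
  shows "\<bar>inner a b\<bar> \<le> (norm a)\<^sup>2 + (norm b)\<^sup>2"
proof -
  have "\<bar>inner a b\<bar> \<le> norm a * norm b" by (rule Cauchy_Schwarz_ineq2)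
  moreover have "2 * (norm a * norm b) \<le> (norm a)\<^sup>2 + (norm b)\<^sup>2"
    using sum_squares_bound[of "norm a" "norm b"] by simp
  moreover have "0 \<le> norm a * norm b" by simp
  ultimately show ?thesis by linarith
qed

lemma square_integrable_add:
  fixes X Y :: "'w \<Rightarrow> 'a::euclidean_space"
  assumes [measurable]: "X \<in> borel_measurable P" "Y \<in> borel_measurable P"
    and "integrable P (\<lambda>\<omega>. (norm (X \<omega>))\<^sup>2)" "integrable P (\<lambda>\<omega>. (norm (Y \<omega>))\<^sup>2)"
  shows "integrable P (\<lambda>\<omega>. (norm (X \<omega> + Y \<omega>))\<^sup>2)"
proof (rule Bochner_Integration.integrable_bound)
  show "integrable P (\<lambda>\<omega>. 2 * (norm (X \<omega>))\<^sup>2 + 2 * (norm (Y \<omega>))\<^sup>2)"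
    using assms by simp
qed (auto intro!: AE_I2 order_trans[OF norm_add_square_le])

lemma square_integrable_scaleR:
  fixes X :: "'w \<Rightarrow> 'a::euclidean_space"
  assumes "integrable P (\<lambda>\<omega>. (norm (X \<omega>))\<^sup>2)"
  shows "integrable P (\<lambda>\<omega>. (norm (c *\<^sub>R X \<omega>))\<^sup>2)"
  using assms by (simp add: power_mult_distrib)

lemma integrable_inner_square_integrable:
  fixes X Y :: "'w \<Rightarrow> 'a::euclidean_space"
  assumes [measurable]: "X \<in> borel_measurable P" "Y \<in> borel_measurable P"
    and "integrable P (\<lambda>\<omega>. (norm (X \<omega>))\<^sup>2)" "integrable P (\<lambda>\<omega>. (norm (Y \<omega>))\<^sup>2)"
  shows "integrable P (\<lambda>\<omega>. inner (X \<omega>) (Y \<omega>))"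
proof (rule Bochner_Integration.integrable_bound)
  show "integrable P (\<lambda>\<omega>. (norm (X \<omega>))\<^sup>2 + (norm (Y \<omega>))\<^sup>2)"
    using assms by simp
qed (auto intro!: AE_I2 order_trans[OF abs_inner_le_squares])

lemma borel_measurable_vec_nth [measurable (raw)]:
  fixes X :: "'w \<Rightarrow> real ^ 'd"
  assumes "X \<in> borel_measurable P"
  shows "(\<lambda>\<omega>. X \<omega> $ i) \<in> borel_measurable P"
  by (rule measurable_compose[OF assms])
    (intro borel_measurable_continuous_onI continuous_on_component continuous_on_id)

section \<open>Weighted averages under a drift condition\<close>

text \<open>Summing the drift condition telescopes \<open>D\<close>, so beyond \<open>N\<close> the
  weighted sum exceeds \<epsilon> times the total weight by at most a constant, which the divergent
  total weight absorbs. \<open>N\<close> and \<open>D\<close> may depend on \<epsilon>, because the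
  application changes the Lyapunov function with the accuracy.\<close>

lemma weighted_average_tendsto_0:
  fixes \<alpha> \<Phi> :: "nat \<Rightarrow> real"
  assumes pos: "\<And>k. k \<ge> 1 \<Longrightarrow> \<alpha> k > 0" and \<Phi>: "\<And>k. \<Phi> k \<ge> 0"
    and S: "filterlim (\<lambda>n. \<Sum>k=1..n. \<alpha> k) at_top sequentially"
    and drift: "\<And>\<epsilon>. \<epsilon> > 0 \<Longrightarrow> \<exists>N D. (\<forall>k. D k \<ge> 0) \<and>
      (\<forall>k>N. \<alpha> k * \<Phi> (k - 1) \<le> D (k - 1) - D k + \<epsilon> * \<alpha> k)"
  shows "(\<lambda>n. (\<Sum>k=1..n. \<alpha> k * \<Phi> (k - 1)) / (\<Sum>k=1..n. \<alpha> k)) \<longlonglongrightarrow> 0"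
proof (rule tendstoI)
  fix e :: real assume "e > 0"
  then obtain N D where D: "\<And>k. D k \<ge> (0::real)"
    "\<And>k. k > N \<Longrightarrow> \<alpha> k * \<Phi> (k - 1) \<le> D (k - 1) - D k + e / 2 * \<alpha> k"
    using drift[of "e / 2"] by auto
  \<comment> \<open>\<open>C\<close> collects the terms up to \<open>N\<close>, about which the
    drift condition says nothing, and the starting value of the telescoping sum.\<close>
  define C where "C = (\<Sum>k=1..N. \<alpha> k * \<Phi> (k - 1)) + D N"
  have bound: "(\<Sum>k=1..n. \<alpha> k * \<Phi> (k - 1)) + D n \<le> C + e / 2 * (\<Sum>k=1..n. \<alpha> k)" if "n \<ge> N" for n
    using that
  proof (induction n rule: dec_induct)
    case base
    have "0 \<le> (\<Sum>k=1..N. \<alpha> k)" using pos by (intro sum_nonneg) (simp add: less_imp_le)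
    then show ?case using \<open>e > 0\<close> by (simp add: C_def)
  next
    case (step n)
    then show ?case using D(2)[of "Suc n"] by (simp add: algebra_simps)
  qed
  \<comment> \<open>Beyond total weight \<open>2 * C / e\<close> the constant \<open>C\<close> costs
    less than \<open>e / 2\<close> per unit of weight; the drift costs the other
    \<open>e / 2\<close>.\<close>
  have "\<forall>\<^sub>F n in sequentially. (\<Sum>k=1..n. \<alpha> k) > max 0 (2 * C / e)"
    using S unfolding filterlim_at_top_dense by blast
  then have "\<forall>\<^sub>F n in sequentially. n \<ge> N \<and> (\<Sum>k=1..n. \<alpha> k) > max 0 (2 * C / e)"
    by (intro eventually_conj eventually_ge_at_top)
  then show "\<forall>\<^sub>F n in sequentially.
      dist ((\<Sum>k=1..n. \<alpha> k * \<Phi> (k - 1)) / (\<Sum>k=1..n. \<alpha> k)) 0 < e"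
  proof eventually_elim
    case (elim n)
    let ?S = "\<Sum>k=1..n. \<alpha> k" and ?T = "\<Sum>k=1..n. \<alpha> k * \<Phi> (k - 1)"
    have "0 \<le> ?T" using pos \<Phi> by (intro sum_nonneg mult_nonneg_nonneg) (simp_all add: less_imp_le)
    moreover have "0 < ?S" "C < e / 2 * ?S"
      using elim \<open>e > 0\<close> by (auto simp: field_simps)
    moreover have "?T \<le> C + e / 2 * ?S" using bound[of n] D(1)[of n] elim by linarith
    ultimately have "0 \<le> ?T / ?S" "?T / ?S < e" by (auto simp: field_simps)
    then show ?case by (simp only: dist_real_def diff_zero abs_of_nonneg)
  qed
qed

section \<open>The SGD process and its filtration\<close>

text \<open>The step sizes are only positive here. Their convergence to 0 and the divergence of
  their sum are asymptotic and are assumed separately where the limit is taken.\<close>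

locale sgd = prob_space P for P :: "'w measure" +
  fixes f :: "real ^ 'd \<Rightarrow> real"
    and xstar :: "real ^ 'd"
    and L M V :: real
    and \<alpha> :: "nat \<Rightarrow> real"
    and x \<xi> :: "nat \<Rightarrow> 'w \<Rightarrow> real ^ 'd"
  assumes C1: "continuously_differentiable f"
    and convex: "convex_on UNIV f"
    and L_pos: "L > 0"
    and smooth: "L_smooth L f"
    and minimum: "f xstar \<le> f y"
    and alpha_pos: "k \<ge> 1 \<Longrightarrow> \<alpha> k > 0"
    and x0_meas: "x 0 \<in> borel_measurable P"
    and x0_int: "integrable P (\<lambda>\<omega>. f (x 0 \<omega>))"
    and xi_meas: "k \<ge> 1 \<Longrightarrow> \<xi> k \<in> borel_measurable P"
    and step: "k \<ge> 1 \<Longrightarrow> \<omega> \<in> space P \<Longrightarrow>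
      x k \<omega> = x (k - 1) \<omega> - \<alpha> k *\<^sub>R grad f (x (k - 1) \<omega>) + \<alpha> k *\<^sub>R \<xi> k \<omega>"
    and M_nonneg: "M \<ge> 0"
    and V_nonneg: "V \<ge> 0"
    and noise_mean: "k \<ge> 1 \<Longrightarrow> AE \<omega> in P.
      vec_cond_exp P (sgd_filtration P (x 0) \<xi> (k - 1)) (\<xi> k) \<omega> = 0"
    and noise_second_moment: "k \<ge> 1 \<Longrightarrow> AE \<omega> in P.
      nn_cond_exp P (sgd_filtration P (x 0) \<xi> (k - 1)) (\<lambda>\<omega>'. ennreal ((norm (\<xi> k \<omega>'))\<^sup>2)) \<omega>
        \<le> ennreal (M + V * (norm (grad f (x (k - 1) \<omega>)))\<^sup>2)"
begin

abbreviation F :: "nat \<Rightarrow> 'w measure" where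
  "F \<equiv> sgd_filtration P (x 0) \<xi>"

lemma differentiable: "f differentiable (at y)"
  using C1 by (simp add: continuously_differentiable_def)

lemma f_measurable [measurable]: "f \<in> borel_measurable borel"
  by (intro borel_measurable_continuous_onI differentiable_imp_continuous_on)
    (simp add: differentiable_on_def differentiable_at_withinI differentiable)

lemma grad_measurable [measurable]: "grad f \<in> borel_measurable borel"
  using C1 by (intro borel_measurable_continuous_onI) (simp add: continuously_differentiable_def)

lemma grad_norm_bound: "(norm (grad f y))\<^sup>2 \<le> 4 * L * (f y - f xstar)"
  using convex differentiable smooth L_pos minimum by (rule smooth_convex_grad_norm_bound)

lemma filtration_sets:
  "space (F k) = space P"
  "sets (F k) = sigma_sets (space P) ({x 0 -` A \<inter> space P | A. A \<in> sets borel} \<union>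
      (\<Union>i\<in>{1..k}. {\<xi> i -` A \<inter> space P | A. A \<in> sets borel}))"
  unfolding sgd_filtration_def
  by (auto intro!: space_measure_of sets_measure_of)

lemma subalgebra_filtration: "subalgebra P (F k)"
  unfolding subalgebra_def filtration_sets
  using x0_meas xi_meas by (auto intro!: sets.sigma_sets_subset measurable_sets)

lemma finite_measure_subalgebra_filtration: "finite_measure_subalgebra P (F k)"
  by (intro finite_measure_subalgebra.intro finite_measure_axioms
      finite_measure_subalgebra_axioms.intro subalgebra_filtration)

lemma noise_measurable_filtration:
  assumes "1 \<le> i" "i \<le> k"
  shows "\<xi> i \<in> borel_measurable (F k)"
proof (rule measurableI)
  fix A :: "(real ^ 'd) set" assume "A \<in> sets borel"
  then show "\<xi> i -` A \<inter> space (F k) \<in> sets (F k)"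
    using assms unfolding filtration_sets by (intro sigma_sets.Basic) auto
qed simp

text \<open>Allowing any \<open>k\<close> above \<open>j\<close> lets the induction on
  \<open>j\<close> stay in one fixed \<sigma>-algebra. As the recursion is only known on
  \<open>space P\<close>, measurability is transferred from its right-hand side by agreement on that
  space.\<close>

lemma iterate_measurable_filtration:
  assumes "j \<le> k"
  shows "x j \<in> borel_measurable (F k)"
  using assms
proof (induction j)
  case 0
  show ?case
  proof (rule measurableI)
    fix A :: "(real ^ 'd) set" assume "A \<in> sets borel"
    then show "x 0 -` A \<inter> space (F k) \<in> sets (F k)"
      unfolding filtration_sets by (intro sigma_sets.Basic) auto
  qed simp
next
  case (Suc j)
  then have [measurable]: "x j \<in> borel_measurable (F k)" by simp
  have [measurable]: "\<xi> (Suc j) \<in> borel_measurable (F k)"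
    using Suc.prems by (intro noise_measurable_filtration) auto
  have "(\<lambda>\<omega>. x j \<omega> - \<alpha> (Suc j) *\<^sub>R grad f (x j \<omega>) + \<alpha> (Suc j) *\<^sub>R \<xi> (Suc j) \<omega>)
      \<in> borel_measurable (F k)"
    by measurable
  then show ?case
    using step[of "Suc j"] by (subst measurable_cong) (auto simp: filtration_sets(1))
qed

lemma iterate_measurable [measurable]: "x k \<in> borel_measurable P"
  using measurable_from_subalg[OF subalgebra_filtration iterate_measurable_filtration[OF order_refl]] .

section \<open>Integrability of gradients, noise and objective values\<close>

text \<open>The iterates themselves may lack second moments. \<open>grad_norm_bound\<close> turns
  integrability of the objective into the second moment of the gradient, which is all that the noise
  bound requires.\<close>

lemma integrable_grad_square:
  assumes "integrable P (\<lambda>\<omega>. f (x k \<omega>))"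
  shows "integrable P (\<lambda>\<omega>. (norm (grad f (x k \<omega>)))\<^sup>2)"
proof (rule Bochner_Integration.integrable_bound)
  show "integrable P (\<lambda>\<omega>. 4 * L * (f (x k \<omega>) - f xstar))"
    using assms by simp
  show "AE \<omega> in P. norm ((norm (grad f (x k \<omega>)))\<^sup>2) \<le> norm (4 * L * (f (x k \<omega>) - f xstar))"
    by (intro AE_I2) (smt (verit) grad_norm_bound real_norm_def zero_le_power2)
qed measurable

text \<open>Square integrability of the noise is a conclusion, so the argument starts with
  nonnegative integrals, where conditioning needs no integrability. The finite bound obtained there
  then permits the return to real integrals.\<close>

lemma noise_square:
  assumes k: "k \<ge> 1" and int: "integrable P (\<lambda>\<omega>. f (x (k - 1) \<omega>))"
  shows "integrable P (\<lambda>\<omega>. (norm (\<xi> k \<omega>))\<^sup>2)"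
    and "(\<integral>\<omega>. (norm (\<xi> k \<omega>))\<^sup>2 \<partial>P) \<le> M + V * (\<integral>\<omega>. (norm (grad f (x (k - 1) \<omega>)))\<^sup>2 \<partial>P)"
proof -
  interpret Fk: finite_measure_subalgebra P "F (k - 1)"
    by (rule finite_measure_subalgebra_filtration)
  let ?h = "\<lambda>\<omega>. M + V * (norm (grad f (x (k - 1) \<omega>)))\<^sup>2"
  have [measurable]: "\<xi> k \<in> borel_measurable P" using xi_meas k .
  have h: "integrable P ?h" using integrable_grad_square[OF int] by simp
  have h0: "0 \<le> ?h \<omega>" for \<omega> using M_nonneg V_nonneg by simp
  have "(\<integral>\<^sup>+\<omega>. ennreal ((norm (\<xi> k \<omega>))\<^sup>2) \<partial>P) =
      (\<integral>\<^sup>+\<omega>. 1 * nn_cond_exp P (F (k - 1)) (\<lambda>\<omega>. ennreal ((norm (\<xi> k \<omega>))\<^sup>2)) \<omega> \<partial>P)"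
    by (subst Fk.nn_cond_exp_intg) simp_all
  also have "\<dots> \<le> (\<integral>\<^sup>+\<omega>. ennreal (?h \<omega>) \<partial>P)"
    using noise_second_moment[OF k] by (intro nn_integral_mono_AE) simp
  also have "\<dots> = ennreal (\<integral>\<omega>. ?h \<omega> \<partial>P)"
    using h h0 by (intro nn_integral_eq_integral) auto
  finally have le: "(\<integral>\<^sup>+\<omega>. ennreal ((norm (\<xi> k \<omega>))\<^sup>2) \<partial>P) \<le> ennreal (\<integral>\<omega>. ?h \<omega> \<partial>P)" .
  show int2: "integrable P (\<lambda>\<omega>. (norm (\<xi> k \<omega>))\<^sup>2)"
    by (rule integrableI_nonneg) (use le in \<open>auto intro: le_less_trans\<close>)
  have "ennreal (\<integral>\<omega>. (norm (\<xi> k \<omega>))\<^sup>2 \<partial>P) \<le> ennreal (\<integral>\<omega>. ?h \<omega> \<partial>P)"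
    using le nn_integral_eq_integral[OF int2] by simp
  then have "(\<integral>\<omega>. (norm (\<xi> k \<omega>))\<^sup>2 \<partial>P) \<le> (\<integral>\<omega>. ?h \<omega> \<partial>P)"
    using h0 by (subst (asm) ennreal_le_iff) (auto intro: integral_nonneg)
  also have "\<dots> = M + V * (\<integral>\<omega>. (norm (grad f (x (k - 1) \<omega>)))\<^sup>2 \<partial>P)"
    using integrable_grad_square[OF int] by (simp add: prob_space)
  finally show "(\<integral>\<omega>. (norm (\<xi> k \<omega>))\<^sup>2 \<partial>P) \<le> \<dots>" .
qed

text \<open>By induction: \<open>f\<close> at the next iterate lies between \<open>f xstar\<close>
  and the quadratic bound \<open>?u\<close> around the current one. Besides the current objective
  value, \<open>?u\<close> contains only the gradient and the increment \<open>?d\<close>, both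
  square integrable by the induction hypothesis.\<close>

lemma integrable_objective: "integrable P (\<lambda>\<omega>. f (x k \<omega>))"
proof (induction k)
  case 0
  show ?case by (rule x0_int)
next
  case (Suc k)
  let ?g = "\<lambda>\<omega>. grad f (x k \<omega>)" and ?a = "\<alpha> (Suc k)"
  let ?d = "\<lambda>\<omega>. (- ?a) *\<^sub>R ?g \<omega> + ?a *\<^sub>R \<xi> (Suc k) \<omega>"
  let ?u = "\<lambda>\<omega>. f (x k \<omega>) + inner (?g \<omega>) (?d \<omega>) + L * (norm (?d \<omega>))\<^sup>2"
  have [measurable]: "\<xi> (Suc k) \<in> borel_measurable P" by (simp add: xi_meas)
  have g: "integrable P (\<lambda>\<omega>. (norm (?g \<omega>))\<^sup>2)"
    by (rule integrable_grad_square[OF Suc])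
  have d: "integrable P (\<lambda>\<omega>. (norm (?d \<omega>))\<^sup>2)"
    using g noise_square(1)[of "Suc k"] Suc
    by (intro square_integrable_add square_integrable_scaleR) auto
  have u: "integrable P ?u"
    using Suc g d by (intro Bochner_Integration.integrable_add integrable_mult_right
        integrable_inner_square_integrable) auto
  have le: "f (x (Suc k) \<omega>) \<le> ?u \<omega>" if "\<omega> \<in> space P" for \<omega>
  proof -
    have "x (Suc k) \<omega> - x k \<omega> = ?d \<omega>" using step[of "Suc k"] that by simp
    then show ?thesis
      using smooth_convex_upper_bound[OF convex differentiable smooth, of "x (Suc k) \<omega>" "x k \<omega>"]
      by simp
  qed
  show ?case
  proof (rule Bochner_Integration.integrable_bound)
    show "integrable P (\<lambda>\<omega>. \<bar>?u \<omega>\<bar> + \<bar>f xstar\<bar>)" using u by simp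
    show "AE \<omega> in P. norm (f (x (Suc k) \<omega>)) \<le> norm (\<bar>?u \<omega>\<bar> + \<bar>f xstar\<bar>)"
    proof (rule AE_I2)
      fix \<omega> assume "\<omega> \<in> space P"
      then show "norm (f (x (Suc k) \<omega>)) \<le> norm (\<bar>?u \<omega>\<bar> + \<bar>f xstar\<bar>)"
        using le[of \<omega>] minimum[of "x (Suc k) \<omega>"] unfolding real_norm_def by linarith
    qed
  qed measurable
qed

section \<open>Orthogonality of the noise and the one-step Lyapunov estimate\<close>

text \<open>Conditional means of vectors are taken coordinatewise, so the inner product is split
  into coordinates. Each coordinate of \<open>W\<close> is known at time \<open>k - 1\<close> and
  can be moved past the conditional expectation, which vanishes almost everywhere; square
  integrability makes the products integrable.\<close>

lemma noise_orthogonal: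
  assumes k: "k \<ge> 1" and W: "W \<in> borel_measurable (F (k - 1))"
    and W2: "integrable P (\<lambda>\<omega>. (norm (W \<omega>))\<^sup>2)"
  shows "(\<integral>\<omega>. inner (W \<omega>) (\<xi> k \<omega>) \<partial>P) = 0"
proof -
  interpret Fk: finite_measure_subalgebra P "F (k - 1)"
    by (rule finite_measure_subalgebra_filtration)
  have [measurable]: "\<xi> k \<in> borel_measurable P" using xi_meas k .
  have WP [measurable]: "W \<in> borel_measurable P"
    using measurable_from_subalg[OF subalgebra_filtration W] .
  have int: "integrable P (\<lambda>\<omega>. W \<omega> $ i * \<xi> k \<omega> $ i)" for i
  proof (rule Bochner_Integration.integrable_bound)
    show "integrable P (\<lambda>\<omega>. (norm (W \<omega>))\<^sup>2 + (norm (\<xi> k \<omega>))\<^sup>2)"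
      using W2 noise_square(1)[OF k integrable_objective] by simp
    have "\<bar>W \<omega> $ i * \<xi> k \<omega> $ i\<bar> \<le> (norm (W \<omega>))\<^sup>2 + (norm (\<xi> k \<omega>))\<^sup>2" for \<omega>
    proof -
      have "\<bar>W \<omega> $ i * \<xi> k \<omega> $ i\<bar> \<le> (W \<omega> $ i)\<^sup>2 + (\<xi> k \<omega> $ i)\<^sup>2"
        using abs_inner_le_squares[of "W \<omega> $ i" "\<xi> k \<omega> $ i"] by simp
      also have "\<dots> \<le> (norm (W \<omega>))\<^sup>2 + (norm (\<xi> k \<omega>))\<^sup>2"
        using component_le_norm_cart[of "W \<omega>" i] component_le_norm_cart[of "\<xi> k \<omega>" i]
        by (intro add_mono) (simp_all add: abs_le_square_iff[symmetric])
      finally show ?thesis .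
    qed
    then show "AE \<omega> in P. norm (W \<omega> $ i * \<xi> k \<omega> $ i) \<le> norm ((norm (W \<omega>))\<^sup>2 + (norm (\<xi> k \<omega>))\<^sup>2)"
      by (intro AE_I2) simp
  qed measurable
  have zero: "(\<integral>\<omega>. W \<omega> $ i * \<xi> k \<omega> $ i \<partial>P) = 0" for i
  proof -
    have "(\<integral>\<omega>. W \<omega> $ i * \<xi> k \<omega> $ i \<partial>P) =
        (\<integral>\<omega>. W \<omega> $ i * real_cond_exp P (F (k - 1)) (\<lambda>\<omega>. \<xi> k \<omega> $ i) \<omega> \<partial>P)"
      by (intro Fk.real_cond_exp_intg(2)[symmetric] int borel_measurable_vec_nth W) measurable
    also have "\<dots> = (\<integral>\<omega>. 0 \<partial>P)"
    proof (rule integral_cong_AE)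
      show "AE \<omega> in P. W \<omega> $ i * real_cond_exp P (F (k - 1)) (\<lambda>\<omega>. \<xi> k \<omega> $ i) \<omega> = 0"
        using noise_mean[OF k] by eventually_elim (simp add: vec_cond_exp_def vec_eq_iff)
    qed measurable
    finally show ?thesis by simp
  qed
  show ?thesis
    unfolding inner_vec_def using int zero by simp
qed

text \<open>Since \<open>Z\<close> is known at time 0, the noise is orthogonal to everything else in
  \<open>x k - Z\<close> and contributes only its second moment. Only the distance to
  \<open>Z\<close> has to be square integrable, and this property passes from \<open>k - 1\<close>
  to \<open>k\<close>.\<close>

lemma lyapunov_step:
  assumes k: "k \<ge> 1" and Z: "Z \<in> borel_measurable (F 0)"
    and fZ: "integrable P (\<lambda>\<omega>. f (Z \<omega>))"
    and int: "integrable P (\<lambda>\<omega>. (norm (x (k - 1) \<omega> - Z \<omega>))\<^sup>2)"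
  shows "integrable P (\<lambda>\<omega>. (norm (x k \<omega> - Z \<omega>))\<^sup>2)"
    and "(\<integral>\<omega>. (norm (x k \<omega> - Z \<omega>))\<^sup>2 \<partial>P) \<le> (\<integral>\<omega>. (norm (x (k - 1) \<omega> - Z \<omega>))\<^sup>2 \<partial>P)
      - 2 * \<alpha> k * ((\<integral>\<omega>. f (x (k - 1) \<omega>) \<partial>P) - (\<integral>\<omega>. f (Z \<omega>) \<partial>P))
      + (\<alpha> k)\<^sup>2 * (4 * L * (1 + V) * ((\<integral>\<omega>. f (x (k - 1) \<omega>) \<partial>P) - f xstar) + M)"
proof -
  let ?x = "x (k - 1)" and ?a = "\<alpha> k"
  let ?g = "\<lambda>\<omega>. grad f (?x \<omega>)"
  \<comment> \<open>The displacement from \<open>Z\<close> after the noiseless part of the step,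
    written as a sum of scaled vectors to fit the closure lemmas for square integrability.\<close>
  let ?W = "\<lambda>\<omega>. (?x \<omega> - Z \<omega>) + (- ?a) *\<^sub>R ?g \<omega>"
  have [measurable]: "\<xi> k \<in> borel_measurable P" using xi_meas k .
  have [measurable]: "Z \<in> borel_measurable P"
    using measurable_from_subalg[OF subalgebra_filtration Z] .
  have "subalgebra (F (k - 1)) (F 0)"
    unfolding subalgebra_def filtration_sets by (auto intro!: sigma_sets_mono')
  from measurable_from_subalg[OF this Z]
  have [measurable]: "Z \<in> borel_measurable (F (k - 1))" .
  have [measurable]: "?x \<in> borel_measurable (F (k - 1))"
    by (simp add: iterate_measurable_filtration)
  have g: "integrable P (\<lambda>\<omega>. (norm (?g \<omega>))\<^sup>2)"
    by (rule integrable_grad_square[OF integrable_objective])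
  note \<xi> = noise_square[OF k integrable_objective]
  have W: "integrable P (\<lambda>\<omega>. (norm (?W \<omega>))\<^sup>2)"
    by (intro square_integrable_add square_integrable_scaleR int g) measurable
  have "?W \<in> borel_measurable (F (k - 1))" by measurable
  then have orth: "(\<integral>\<omega>. inner (?W \<omega>) (\<xi> k \<omega>) \<partial>P) = 0"
    using k W by (intro noise_orthogonal)
  have cross: "integrable P (\<lambda>\<omega>. inner (?W \<omega>) (\<xi> k \<omega>))"
    by (intro integrable_inner_square_integrable W \<xi>(1)) measurable
  have expand: "(norm (x k \<omega> - Z \<omega>))\<^sup>2 =
      (norm (?W \<omega>))\<^sup>2 + 2 * ?a * inner (?W \<omega>) (\<xi> k \<omega>) + ?a\<^sup>2 * (norm (\<xi> k \<omega>))\<^sup>2"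
    if "\<omega> \<in> space P" for \<omega>
  proof -
    have "x k \<omega> - Z \<omega> = ?W \<omega> + ?a *\<^sub>R \<xi> k \<omega>" using step[OF k that] by simp
    moreover have "(norm (w + ?a *\<^sub>R v))\<^sup>2 = (norm w)\<^sup>2 + 2 * ?a * inner w v + ?a\<^sup>2 * (norm v)\<^sup>2"
      for w v :: "real ^ 'd"
      unfolding power2_norm_eq_inner
      by (simp add: inner_add_left inner_add_right inner_commute power2_eq_square)
    ultimately show ?thesis by metis
  qed
  have rhs: "integrable P (\<lambda>\<omega>. (norm (?W \<omega>))\<^sup>2 + 2 * ?a * inner (?W \<omega>) (\<xi> k \<omega>)
      + ?a\<^sup>2 * (norm (\<xi> k \<omega>))\<^sup>2)"
    by (intro Bochner_Integration.integrable_add integrable_mult_right W cross \<xi>(1))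
  then show "integrable P (\<lambda>\<omega>. (norm (x k \<omega> - Z \<omega>))\<^sup>2)"
    by (subst Bochner_Integration.integrable_cong[OF refl expand])
  have "(\<integral>\<omega>. (norm (x k \<omega> - Z \<omega>))\<^sup>2 \<partial>P) = (\<integral>\<omega>. (norm (?W \<omega>))\<^sup>2
      + 2 * ?a * inner (?W \<omega>) (\<xi> k \<omega>) + ?a\<^sup>2 * (norm (\<xi> k \<omega>))\<^sup>2 \<partial>P)"
    by (rule Bochner_Integration.integral_cong[OF refl expand])
  also have "\<dots> = (\<integral>\<omega>. (norm (?W \<omega>))\<^sup>2 + 2 * ?a * inner (?W \<omega>) (\<xi> k \<omega>) \<partial>P)
      + (\<integral>\<omega>. ?a\<^sup>2 * (norm (\<xi> k \<omega>))\<^sup>2 \<partial>P)"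
    by (intro Bochner_Integration.integral_add Bochner_Integration.integrable_add
        integrable_mult_right W cross \<xi>(1))
  also have "(\<integral>\<omega>. (norm (?W \<omega>))\<^sup>2 + 2 * ?a * inner (?W \<omega>) (\<xi> k \<omega>) \<partial>P)
      = (\<integral>\<omega>. (norm (?W \<omega>))\<^sup>2 \<partial>P) + (\<integral>\<omega>. 2 * ?a * inner (?W \<omega>) (\<xi> k \<omega>) \<partial>P)"
    by (intro Bochner_Integration.integral_add integrable_mult_right W cross)
  finally have eq: "(\<integral>\<omega>. (norm (x k \<omega> - Z \<omega>))\<^sup>2 \<partial>P) =
      (\<integral>\<omega>. (norm (?W \<omega>))\<^sup>2 \<partial>P) + ?a\<^sup>2 * (\<integral>\<omega>. (norm (\<xi> k \<omega>))\<^sup>2 \<partial>P)"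
    using orth by simp
  \<comment> \<open>The gradient inequality is applied for each outcome, so a random comparison
    point \<open>Z\<close> is as good as a fixed one.\<close>
  have W_le: "(norm (?W \<omega>))\<^sup>2 \<le> (norm (?x \<omega> - Z \<omega>))\<^sup>2
      - 2 * ?a * (f (?x \<omega>) - f (Z \<omega>)) + ?a\<^sup>2 * (norm (?g \<omega>))\<^sup>2" for \<omega>
  proof -
    have "f (?x \<omega>) - f (Z \<omega>) \<le> inner (?g \<omega>) (?x \<omega> - Z \<omega>)"
      using convex_on_grad_inequality[OF convex differentiable, of "?x \<omega>" "Z \<omega>"]
      by (simp add: inner_diff_right)
    then have "2 * ?a * (f (?x \<omega>) - f (Z \<omega>)) \<le> 2 * ?a * inner (?g \<omega>) (?x \<omega> - Z \<omega>)"
      using alpha_pos[OF k] by (intro mult_left_mono) auto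
    moreover have "(norm (w + (- ?a) *\<^sub>R v))\<^sup>2 = (norm w)\<^sup>2 - 2 * ?a * inner v w + ?a\<^sup>2 * (norm v)\<^sup>2"
      for w v :: "real ^ 'd"
      unfolding power2_norm_eq_inner
      by (simp add: inner_add_left inner_add_right inner_diff_left inner_diff_right inner_commute
          power2_eq_square)
    ultimately show ?thesis by simp
  qed
  have "(\<integral>\<omega>. (norm (?W \<omega>))\<^sup>2 \<partial>P) \<le> (\<integral>\<omega>. (norm (?x \<omega> - Z \<omega>))\<^sup>2
      - 2 * ?a * (f (?x \<omega>) - f (Z \<omega>)) + ?a\<^sup>2 * (norm (?g \<omega>))\<^sup>2 \<partial>P)"
    using int g fZ integrable_objective[of "k - 1"] by (intro integral_mono W W_le) simp_all
  also have "\<dots> = (\<integral>\<omega>. (norm (?x \<omega> - Z \<omega>))\<^sup>2 \<partial>P)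
      - 2 * ?a * ((\<integral>\<omega>. f (?x \<omega>) \<partial>P) - (\<integral>\<omega>. f (Z \<omega>) \<partial>P)) + ?a\<^sup>2 * (\<integral>\<omega>. (norm (?g \<omega>))\<^sup>2 \<partial>P)"
    using int g fZ integrable_objective[of "k - 1"] by simp
  finally have W_int: "(\<integral>\<omega>. (norm (?W \<omega>))\<^sup>2 \<partial>P) \<le> \<dots>" .
  have "(\<integral>\<omega>. (norm (?g \<omega>))\<^sup>2 \<partial>P) \<le> (\<integral>\<omega>. 4 * L * (f (?x \<omega>) - f xstar) \<partial>P)"
    using g integrable_objective[of "k - 1"] by (intro integral_mono grad_norm_bound) simp_all
  also have "\<dots> = 4 * L * ((\<integral>\<omega>. f (?x \<omega>) \<partial>P) - f xstar)"
    using integrable_objective[of "k - 1"] by (simp add: prob_space)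
  finally have G: "(\<integral>\<omega>. (norm (?g \<omega>))\<^sup>2 \<partial>P) \<le> 4 * L * ((\<integral>\<omega>. f (?x \<omega>) \<partial>P) - f xstar)" .
  \<comment> \<open>One gradient second moment comes from \<open>?W\<close> and \<open>V\<close> of
    them from the noise, hence the factor \<open>1 + V\<close>.\<close>
  have "(\<integral>\<omega>. (norm (?g \<omega>))\<^sup>2 \<partial>P) + (\<integral>\<omega>. (norm (\<xi> k \<omega>))\<^sup>2 \<partial>P)
      \<le> (1 + V) * (\<integral>\<omega>. (norm (?g \<omega>))\<^sup>2 \<partial>P) + M"
    using \<xi>(2) by (simp add: algebra_simps)
  also have "\<dots> \<le> (1 + V) * (4 * L * ((\<integral>\<omega>. f (?x \<omega>) \<partial>P) - f xstar)) + M"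
    using V_nonneg G by (intro add_mono mult_left_mono) auto
  also have "\<dots> = 4 * L * (1 + V) * ((\<integral>\<omega>. f (?x \<omega>) \<partial>P) - f xstar) + M"
    by simp
  finally have "?a\<^sup>2 * ((\<integral>\<omega>. (norm (?g \<omega>))\<^sup>2 \<partial>P) + (\<integral>\<omega>. (norm (\<xi> k \<omega>))\<^sup>2 \<partial>P))
      \<le> ?a\<^sup>2 * (4 * L * (1 + V) * ((\<integral>\<omega>. f (?x \<omega>) \<partial>P) - f xstar) + M)"
    by (intro mult_left_mono) auto
  then show "(\<integral>\<omega>. (norm (x k \<omega> - Z \<omega>))\<^sup>2 \<partial>P) \<le> (\<integral>\<omega>. (norm (?x \<omega> - Z \<omega>))\<^sup>2 \<partial>P)
      - 2 * ?a * ((\<integral>\<omega>. f (?x \<omega>) \<partial>P) - (\<integral>\<omega>. f (Z \<omega>) \<partial>P))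
      + ?a\<^sup>2 * (4 * L * (1 + V) * ((\<integral>\<omega>. f (?x \<omega>) \<partial>P) - f xstar) + M)"
    using eq W_int unfolding distrib_left[of _ "(\<integral>\<omega>. (norm (?g \<omega>))\<^sup>2 \<partial>P)"]
    by linarith
qed

section \<open>The random reference point and the drift\<close>

text \<open>\<open>x 0 - Z R\<close> is zero or bounded by \<open>real R + norm xstar\<close>. For
  each outcome \<open>Z R\<close> equals \<open>xstar\<close> as soon as \<open>R\<close> reaches
  the norm of \<open>x 0\<close>, and \<open>f (Z R)\<close> is dominated by the integrable
  \<open>\<bar>f (x 0)\<bar> + \<bar>f xstar\<bar>\<close>, so its expectation tends to
  \<open>f xstar\<close>.\<close>

lemma reference_point:
  assumes "\<epsilon> > 0"
  obtains Z where "Z \<in> borel_measurable (F 0)" "integrable P (\<lambda>\<omega>. f (Z \<omega>))"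
    "integrable P (\<lambda>\<omega>. (norm (x 0 \<omega> - Z \<omega>))\<^sup>2)" "(\<integral>\<omega>. f (Z \<omega>) \<partial>P) < f xstar + \<epsilon>"
proof -
  define Z where "Z R \<omega> = (if norm (x 0 \<omega>) \<le> real R then xstar else x 0 \<omega>)" for R \<omega>
  have [measurable]: "x 0 \<in> borel_measurable (F 0)"
    by (rule iterate_measurable_filtration) simp
  have Z: "Z R \<in> borel_measurable (F 0)" for R
    unfolding Z_def by measurable
  have [measurable]: "Z R \<in> borel_measurable P" for R
    using measurable_from_subalg[OF subalgebra_filtration Z] .
  have bound: "AE \<omega> in P. norm (f (Z R \<omega>)) \<le> \<bar>f (x 0 \<omega>)\<bar> + \<bar>f xstar\<bar>" for R
    by (intro AE_I2) (simp add: Z_def)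
  have lim: "AE \<omega> in P. (\<lambda>R. f (Z R \<omega>)) \<longlonglongrightarrow> f xstar"
  proof (rule AE_I2)
    fix \<omega>
    have "\<forall>\<^sub>F R in sequentially. f (Z R \<omega>) = f xstar"
      using eventually_ge_at_top[of "nat \<lceil>norm (x 0 \<omega>)\<rceil>"]
      by eventually_elim (simp add: Z_def nat_ceiling_le_eq)
    then show "(\<lambda>R. f (Z R \<omega>)) \<longlonglongrightarrow> f xstar"
      by (rule tendsto_eventually)
  qed
  have dom: "integrable P (\<lambda>\<omega>. \<bar>f (x 0 \<omega>)\<bar> + \<bar>f xstar\<bar>)" using x0_int by simp
  have fZ: "integrable P (\<lambda>\<omega>. f (Z R \<omega>))" for R
    by (rule integrable_dominated_convergence2[OF _ _ dom lim bound]) measurable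
  have "(\<lambda>R. \<integral>\<omega>. f (Z R \<omega>) \<partial>P) \<longlonglongrightarrow> (\<integral>\<omega>. f xstar \<partial>P)"
    by (rule integral_dominated_convergence[OF _ _ dom lim bound]) measurable
  then have "\<forall>\<^sub>F R in sequentially. (\<integral>\<omega>. f (Z R \<omega>) \<partial>P) < f xstar + \<epsilon>"
    by (rule order_tendstoD(2)) (simp add: prob_space assms)
  then obtain R where R: "(\<integral>\<omega>. f (Z R \<omega>) \<partial>P) < f xstar + \<epsilon>"
    by (auto simp: eventually_sequentially)
  have "integrable P (\<lambda>\<omega>. (norm (x 0 \<omega> - Z R \<omega>))\<^sup>2)"
  proof (rule integrable_const_bound)
    have "(norm (x 0 \<omega> - Z R \<omega>))\<^sup>2 \<le> (real R + norm xstar)\<^sup>2" for \<omega>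
      using norm_triangle_ineq4[of "x 0 \<omega>" xstar] by (auto simp: Z_def intro!: power_mono)
    then show "AE \<omega> in P. norm ((norm (x 0 \<omega> - Z R \<omega>))\<^sup>2) \<le> (real R + norm xstar)\<^sup>2"
      by simp
  qed measurable
  from that[OF Z fZ this R] show thesis .
qed

lemma drift_bound:
  assumes lim: "\<alpha> \<longlonglongrightarrow> 0" and "\<epsilon> > 0"
  shows "\<exists>N D. (\<forall>k. D k \<ge> 0) \<and> (\<forall>k>N.
    \<alpha> k * ((\<integral>\<omega>. f (x (k - 1) \<omega>) \<partial>P) - f xstar) \<le> D (k - 1) - D k + \<epsilon> * \<alpha> k)"
proof -
  \<comment> \<open>The excess of \<open>Z\<close> enters the one-step estimate with factor
    \<open>2 * \<alpha> k\<close>, so \<open>\<epsilon> / 4\<close> spends half of the allowed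
    error.\<close>
  obtain Z where Z: "Z \<in> borel_measurable (F 0)" "integrable P (\<lambda>\<omega>. f (Z \<omega>))"
    "integrable P (\<lambda>\<omega>. (norm (x 0 \<omega> - Z \<omega>))\<^sup>2)" "(\<integral>\<omega>. f (Z \<omega>) \<partial>P) < f xstar + \<epsilon> / 4"
    using reference_point[of "\<epsilon> / 4"] \<open>\<epsilon> > 0\<close> by auto
  define D where "D k = (\<integral>\<omega>. (norm (x k \<omega> - Z \<omega>))\<^sup>2 \<partial>P)" for k
  have int: "integrable P (\<lambda>\<omega>. (norm (x k \<omega> - Z \<omega>))\<^sup>2)" for k
  proof (induction k)
    case (Suc k)
    then show ?case using lyapunov_step(1)[of "Suc k" Z] Z by simp
  qed (rule Z)
  have "(\<lambda>k. 4 * L * (1 + V) * \<alpha> k) \<longlonglongrightarrow> 4 * L * (1 + V) * 0" "(\<lambda>k. M * \<alpha> k) \<longlonglongrightarrow> M * 0"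
    by (intro tendsto_mult_left lim)+
  \<comment> \<open>The first condition lets the gradient error use up at most one of the two copies
    of \<open>\<alpha> k * \<Phi>\<close> in the descent, leaving one copy; the second confines the
    noise constant to the remaining \<open>\<epsilon> / 2\<close>.\<close>
  then have "\<forall>\<^sub>F k in sequentially. 4 * L * (1 + V) * \<alpha> k < 1 \<and> M * \<alpha> k < \<epsilon> / 2"
    using \<open>\<epsilon> > 0\<close> by (intro eventually_conj order_tendstoD(2)) auto
  then obtain N where N: "4 * L * (1 + V) * \<alpha> k < 1" "M * \<alpha> k < \<epsilon> / 2" if "k \<ge> N" for k
    by (auto simp: eventually_sequentially)
  have "\<alpha> k * ((\<integral>\<omega>. f (x (k - 1) \<omega>) \<partial>P) - f xstar) \<le> D (k - 1) - D k + \<epsilon> * \<alpha> k"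
    if "k > N" for k
  proof -
    define \<Phi> where "\<Phi> = (\<integral>\<omega>. f (x (k - 1) \<omega>) \<partial>P) - f xstar"
    define \<delta> where "\<delta> = (\<integral>\<omega>. f (Z \<omega>) \<partial>P) - f xstar"
    have k: "k \<ge> 1" and a: "\<alpha> k > 0" using that alpha_pos[of k] by auto
    have "\<Phi> \<ge> 0"
      unfolding \<Phi>_def
      using integral_mono[OF _ integrable_objective, of "\<lambda>_. f xstar"] minimum by (simp add: prob_space)
    then have 1: "4 * L * (1 + V) * \<alpha> k * (\<alpha> k * \<Phi>) \<le> 1 * (\<alpha> k * \<Phi>)"
      using N[of k] that a by (intro mult_right_mono) auto
    have 2: "M * \<alpha> k * \<alpha> k \<le> \<epsilon> / 2 * \<alpha> k"
      using N[of k] that a by (intro mult_right_mono) auto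
    have 3: "2 * \<alpha> k * \<delta> \<le> 2 * \<alpha> k * (\<epsilon> / 4)"
      using Z(4) a unfolding \<delta>_def by (intro mult_left_mono) auto
    have "D k \<le> D (k - 1) - 2 * \<alpha> k * (\<Phi> - \<delta>) + (\<alpha> k)\<^sup>2 * (4 * L * (1 + V) * \<Phi> + M)"
      using lyapunov_step(2)[OF k Z(1,2) int] unfolding D_def \<Phi>_def \<delta>_def by simp
    also have "\<dots> = D (k - 1) - 2 * (\<alpha> k * \<Phi>) + 2 * \<alpha> k * \<delta>
        + 4 * L * (1 + V) * \<alpha> k * (\<alpha> k * \<Phi>) + M * \<alpha> k * \<alpha> k"
      by (simp add: algebra_simps power2_eq_square)
    finally show ?thesis using 1 2 3 unfolding \<Phi>_def[symmetric] by (simp add: algebra_simps)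
  qed
  moreover have "D k \<ge> 0" for k unfolding D_def by simp
  ultimately show ?thesis by blast
qed

section \<open>Jensen's inequality and the limit\<close>

text \<open>Jensen's inequality for each outcome with weights \<open>\<alpha> k / ?S\<close>;
  \<open>n \<ge> 1\<close> makes the normalising sum positive.\<close>

lemma time_average_objective_le:
  assumes "n \<ge> 1"
  shows "f (time_average \<alpha> x n \<omega>) \<le> (\<Sum>k=1..n. \<alpha> k * f (x (k - 1) \<omega>)) / (\<Sum>k=1..n. \<alpha> k)"
proof -
  let ?S = "\<Sum>k=1..n. \<alpha> k"
  have S: "?S > 0" using assms alpha_pos by (intro sum_pos) auto
  have "f (\<Sum>k=1..n. (\<alpha> k / ?S) *\<^sub>R x (k - 1) \<omega>) \<le> (\<Sum>k=1..n. \<alpha> k / ?S * f (x (k - 1) \<omega>))"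
    using assms S by (intro convex_on_sum[OF _ _ convex])
      (auto simp: sum_divide_distrib[symmetric] alpha_pos less_imp_le)
  also have "(\<Sum>k=1..n. (\<alpha> k / ?S) *\<^sub>R x (k - 1) \<omega>) = time_average \<alpha> x n \<omega>"
    unfolding time_average_def scaleR_sum_right by (simp add: divide_inverse_commute)
  also have "(\<Sum>k=1..n. \<alpha> k / ?S * f (x (k - 1) \<omega>)) = (\<Sum>k=1..n. \<alpha> k * f (x (k - 1) \<omega>)) / ?S"
    by (simp add: sum_divide_distrib)
  finally show ?thesis .
qed

lemma integrable_weighted_objective:
  "integrable P (\<lambda>\<omega>. (\<Sum>k=1..n. \<alpha> k * f (x (k - 1) \<omega>)) / (\<Sum>k=1..n. \<alpha> k))"
  by (intro integrable_divide Bochner_Integration.integrable_sum integrable_mult_right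
      integrable_objective)

text \<open>The value is trapped between \<open>f xstar\<close> and the integrable weighted average.
  Without integrability the expectation would take the default value 0 and the limit would lose its
  meaning.\<close>

lemma integrable_time_average:
  assumes "n \<ge> 1"
  shows "integrable P (\<lambda>\<omega>. f (time_average \<alpha> x n \<omega>))"
proof (rule Bochner_Integration.integrable_bound)
  let ?A = "\<lambda>\<omega>. (\<Sum>k=1..n. \<alpha> k * f (x (k - 1) \<omega>)) / (\<Sum>k=1..n. \<alpha> k)"
  show "integrable P (\<lambda>\<omega>. \<bar>?A \<omega>\<bar> + \<bar>f xstar\<bar>)"
    by (intro Bochner_Integration.integrable_add integrable_abs integrable_weighted_objective) simp
  show "AE \<omega> in P. norm (f (time_average \<alpha> x n \<omega>)) \<le> norm (\<bar>?A \<omega>\<bar> + \<bar>f xstar\<bar>)"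
  proof (rule AE_I2)
    fix \<omega>
    show "norm (f (time_average \<alpha> x n \<omega>)) \<le> norm (\<bar>?A \<omega>\<bar> + \<bar>f xstar\<bar>)"
      using time_average_objective_le[OF assms, of \<omega>] minimum[of "time_average \<alpha> x n \<omega>"]
      unfolding real_norm_def by linarith
  qed
  show "(\<lambda>\<omega>. f (time_average \<alpha> x n \<omega>)) \<in> borel_measurable P"
    unfolding time_average_def by measurable
qed

lemma time_average_tendsto_minimum:
  assumes lim: "\<alpha> \<longlonglongrightarrow> 0"
    and sum: "filterlim (\<lambda>n. \<Sum>k=1..n. \<alpha> k) at_top sequentially"
  shows "(\<lambda>n. \<integral>\<omega>. f (time_average \<alpha> x n \<omega>) \<partial>P) \<longlonglongrightarrow> f xstar"
proof -
  let ?S = "\<lambda>n. \<Sum>k=1..n. \<alpha> k"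
  define \<Phi> where "\<Phi> k = (\<integral>\<omega>. f (x k \<omega>) \<partial>P) - f xstar" for k
  have \<Phi>: "\<Phi> k \<ge> 0" for k
    unfolding \<Phi>_def
    using integral_mono[OF _ integrable_objective, of "\<lambda>_. f xstar"] minimum by (simp add: prob_space)
  have "(\<lambda>n. (\<Sum>k=1..n. \<alpha> k * \<Phi> (k - 1)) / ?S n) \<longlonglongrightarrow> 0"
    using drift_bound[OF lim] unfolding \<Phi>_def[symmetric]
    by (intro weighted_average_tendsto_0 alpha_pos \<Phi> sum)
  then have "(\<lambda>n. f xstar + (\<Sum>k=1..n. \<alpha> k * \<Phi> (k - 1)) / ?S n) \<longlonglongrightarrow> f xstar + 0"
    by (intro tendsto_add tendsto_const)
  then have upper: "(\<lambda>n. f xstar + (\<Sum>k=1..n. \<alpha> k * \<Phi> (k - 1)) / ?S n) \<longlonglongrightarrow> f xstar"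
    by simp
  have "f xstar \<le> (\<integral>\<omega>. f (time_average \<alpha> x n \<omega>) \<partial>P)" if "n \<ge> 1" for n
    using integral_mono[OF _ integrable_time_average[OF that], of "\<lambda>_. f xstar"] minimum
    by (simp add: prob_space)
  moreover have "(\<integral>\<omega>. f (time_average \<alpha> x n \<omega>) \<partial>P)
      \<le> f xstar + (\<Sum>k=1..n. \<alpha> k * \<Phi> (k - 1)) / ?S n" if "n \<ge> 1" for n
  proof -
    have S: "?S n > 0" using that alpha_pos by (intro sum_pos) auto
    have "(\<integral>\<omega>. f (time_average \<alpha> x n \<omega>) \<partial>P)
        \<le> (\<integral>\<omega>. (\<Sum>k=1..n. \<alpha> k * f (x (k - 1) \<omega>)) / ?S n \<partial>P)"
      by (intro integral_mono integrable_time_average integrable_weighted_objective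
          time_average_objective_le that)
    also have "\<dots> = (\<Sum>k=1..n. \<alpha> k * (\<integral>\<omega>. f (x (k - 1) \<omega>) \<partial>P)) / ?S n"
      by (simp add: integrable_objective)
    \<comment> \<open>Recentring at \<open>f xstar\<close> separates the limit from the weighted
      average of the gaps \<Phi>, which tends to 0.\<close>
    also have "(\<Sum>k=1..n. \<alpha> k * (\<integral>\<omega>. f (x (k - 1) \<omega>) \<partial>P))
        = (\<Sum>k=1..n. \<alpha> k * \<Phi> (k - 1)) + f xstar * ?S n"
      by (simp add: \<Phi>_def right_diff_distrib sum_subtractf sum_distrib_left mult.commute)
    also have "\<dots> / ?S n = f xstar + (\<Sum>k=1..n. \<alpha> k * \<Phi> (k - 1)) / ?S n"
      using S by (simp add: add_divide_distrib)
    finally show ?thesis .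
  qed
  ultimately show ?thesis
    by (intro tendsto_sandwich[OF _ _ tendsto_const upper])
      (auto simp: eventually_sequentially)
qed

end


theorem theorem7:
  fixes f :: "real ^ 'd \<Rightarrow> real"
    and xstar :: "real ^ 'd"
    and L M V :: real
    and \<alpha> :: "nat \<Rightarrow> real"
    and P :: "'w measure"
    and x \<xi> :: "nat \<Rightarrow> 'w \<Rightarrow> real ^ 'd"
  assumes C1: "continuously_differentiable f"
    and convex: "convex_on UNIV f"
    and L_pos: "L > 0"
    and smooth: "L_smooth L f"
    and minimum: "\<forall>y. f xstar \<le> f y"
    and alpha_pos: "\<forall>k\<ge>1. \<alpha> k > 0"
    and alpha_lim: "\<alpha> \<longlonglongrightarrow> 0"
    and alpha_sum: "filterlim (\<lambda>n. \<Sum>k=1..n. \<alpha> k) at_top sequentially"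
    and prob: "prob_space P"
    and x0_meas: "x 0 \<in> borel_measurable P"
    and x0_int: "integrable P (\<lambda>\<omega>. f (x 0 \<omega>))"
    and xi_meas: "\<forall>k\<ge>1. \<xi> k \<in> borel_measurable P"
    and sgd: "\<forall>k\<ge>1. \<forall>\<omega>\<in>space P.
      x k \<omega> = x (k - 1) \<omega> - \<alpha> k *\<^sub>R grad f (x (k - 1) \<omega>) + \<alpha> k *\<^sub>R \<xi> k \<omega>"
    and M_nonneg: "M \<ge> 0"
    and V_nonneg: "V \<ge> 0"
    and noise_mean: "\<forall>k\<ge>1. AE \<omega> in P.
      vec_cond_exp P (sgd_filtration P (x 0) \<xi> (k - 1)) (\<xi> k) \<omega> = 0"
    and noise_second_moment: "\<forall>k\<ge>1. AE \<omega> in P.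
      nn_cond_exp P (sgd_filtration P (x 0) \<xi> (k - 1)) (\<lambda>\<omega>'. ennreal ((norm (\<xi> k \<omega>'))\<^sup>2)) \<omega>
        \<le> ennreal (M + V * (norm (grad f (x (k - 1) \<omega>)))\<^sup>2)"
  shows "(\<forall>n\<ge>1. integrable P (\<lambda>\<omega>. f (time_average \<alpha> x n \<omega>))) \<and>
    (\<lambda>n. \<integral>\<omega>. f (time_average \<alpha> x n \<omega>) \<partial>P) \<longlonglongrightarrow> f xstar"
proof -
  interpret prob_space P by (rule prob)
  interpret sgd P f xstar L M V \<alpha> x \<xi>
    using assms by unfold_locales auto
  show ?thesis
    using integrable_time_average time_average_tendsto_minimum[OF alpha_lim alpha_sum] by blast
qed

end
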